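(* Let $\epsilon>0$, $c\ge0$ and $\nu\ge1$. Then for any $\gamma>0$ there exists a constant $C>0$ such that for all $n\ge1$, all $m\le c\,n^{\nu}$ and every instance of Boson-Sampling with $n$ bosons in $m$ modes (i.e. every $U\in U(m)$) whose distribution $\mathcal{D}_U$ satisfies $\|\mathcal{D}_U-\mathcal{Q}\|_1\ge\epsilon$, where $\mathcal{Q}$ is the uniform distribution on $\Phi_{m,n}$, there is an algorithm (which may depend on both distributions) that distinguishes $\mathcal{D}_U$ from $\mathcal{Q}$ from $C\,n^{2+\gamma}$ many samples.
   Context: Boson-Sampling. Let $n\ge1$ (number of bosons) and $m\ge n$ (number of modes). The sample space is $\Phi_{m,n}=\{(s_1,\dots,s_m)\in\mathbb{Z}_{\ge0}^m:\sum_{j=1}^m s_j=n\}$. For $U\in U(m)$ and $S=(s_1,\dots,s_m)\in\Phi_{m,n}$, $U_S\in\mathbb{C}^{n\times n}$ is the matrix obtained from $U$ by keeping only the first $n$ columns and then taking, for each $j=1,\dots,m$, $s_j$ copies of the $j$-th row. The permanent of an $n\times n$ matrix $X$ is $\operatorname{Perm}(X)=\sum_{\tau\in\mathrm{Sym}(\{1,\dots,n\})}\prod_{j=1}^n x_{j,\tau(j)}$. The Boson-Sampling distribution $\mathcal{D}_U$ on $\Phi_{m,n}$ is $\Pr_{\mathcal{D}_U}[S]=|\operatorname{Perm}(U_S)|^2/\prod_{j=1}^m s_j!$. The 1-norm of a vector indexed by $\Phi_{m,n}$ is the sum of the absolute values of its entries. State discrimination setting. Both candidate distributions $\mathcal{P},\mathcal{Q}$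 on the finite sample space $\Phi$ are completely known to the algorithm (no computational restrictions are imposed), so an algorithm receiving $l$ samples is an arbitrary (possibly randomized) decision rule $\Phi^l\to\{\mathcal{P},\mathcal{Q}\}$. It distinguishes $\mathcal{P}$ from $\mathcal{Q}$ if it answers $\mathcal{P}$ with probability at least $2/3$ when given $l$ independent samples from $\mathcal{P}$ and answers $\mathcal{Q}$ with probability at least $2/3$ when given $l$ independent samples from $\mathcal{Q}$. A non-integer number of samples is read as rounded up. *)

theory Defs
  imports
    "HOL-Probability.Probability"
    "HOL-Combinatorics.Multiset_Permutations"
    "Jordan_Normal_Form.Schur_Decomposition"
begin

text \<open>Modes, rows and columns are indexed from 0. An occupation pattern is a list of length
  \<open>m\<close> whose \<open>j\<close>-th entry is the number of bosons in mode \<open>j\<close>.\<close>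

definition occupations :: "nat \<Rightarrow> nat \<Rightarrow> nat list set" where
  "occupations m n = {S. length S = m \<and> sum_list S = n}"

definition permanent :: "'a :: comm_ring_1 Matrix.mat \<Rightarrow> 'a" where
  "permanent A =
     (\<Sum>\<tau> | \<tau> permutes {0..<dim_row A}. \<Prod>i = 0..<dim_row A. A $$ (i, \<tau> i))"

definition unitary_mats :: "nat \<Rightarrow> complex Matrix.mat set" where
  "unitary_mats m =
     {U \<in> carrier_mat m m. mat_adjoint U * U = 1\<^sub>m m \<and> U * mat_adjoint U = 1\<^sub>m m}"

text \<open>Row indices with multiplicity: \<open>S ! j\<close> consecutive copies of each \<open>j\<close>, in increasing order.\<close>

definition row_list :: "nat list \<Rightarrow> nat list" where
  "row_list S = concat (map (\<lambda>j. replicate (S ! j) j) [0..<length S])"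

definition boson_submat :: "nat \<Rightarrow> complex Matrix.mat \<Rightarrow> nat list \<Rightarrow> complex Matrix.mat" where
  "boson_submat n U S = Matrix.mat n n (\<lambda>(i, k). U $$ (row_list S ! i, k))"

definition boson_mass :: "nat \<Rightarrow> nat \<Rightarrow> complex Matrix.mat \<Rightarrow> nat list \<Rightarrow> real" where
  "boson_mass m n U S =
     (if S \<in> occupations m n
      then (cmod (permanent (boson_submat n U S)))\<^sup>2 / (\<Prod>j<m. fact (S ! j))
      else 0)"

text \<open>For unitary \<open>U\<close> and \<open>n \<le> m\<close> the mass function is normalised, so that this is the
  distribution with mass function \<open>boson_mass m n U\<close>; see \<open>pmf_boson_sampling\<close> below.\<close>

definition boson_sampling :: "nat \<Rightarrow> nat \<Rightarrow> complex Matrix.mat \<Rightarrow> nat list pmf" where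
  "boson_sampling m n U = embed_pmf (boson_mass m n U)"

definition l1_dist_on :: "'a set \<Rightarrow> 'a pmf \<Rightarrow> 'a pmf \<Rightarrow> real" where
  "l1_dist_on A p q = (\<Sum>x\<in>A. \<bar>pmf p x - pmf q x\<bar>)"

text \<open>A randomised decision rule maps the list of samples to a distribution over the answers,
  \<open>True\<close> standing for \<open>p\<close> and \<open>False\<close> for \<open>q\<close>.\<close>

definition distinguishes :: "('a list \<Rightarrow> bool pmf) \<Rightarrow> nat \<Rightarrow> 'a pmf \<Rightarrow> 'a pmf \<Rightarrow> bool" where
  "distinguishes A l p q \<longleftrightarrow>
     pmf (bind_pmf (replicate_pmf l p) A) True \<ge> 2 / 3 \<and>
     pmf (bind_pmf (replicate_pmf l q) A) False \<ge> 2 / 3"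


subsection \<open>Normalisation of the mass function\<close>

lemma finite_occupations [simp]: "finite (occupations m n)"
proof (rule finite_subset)
  show "occupations m n \<subseteq> {S. set S \<subseteq> {..n} \<and> length S = m}"
    by (auto simp: occupations_def dest: member_le_sum_list)
  show "finite {S. set S \<subseteq> {..n} \<and> length S = m}"
    by (rule finite_lists_length_eq) auto
qed

lemma occupations_nonempty:
  assumes "0 < m"
  shows "occupations m n \<noteq> {}"
proof -
  have "n # replicate (m - 1) 0 \<in> occupations m n"
    using assms by (simp add: occupations_def sum_list_replicate)
  thus ?thesis by blast
qed

lemma count_row_list: "count (mset (row_list S)) j = (if j < length S then S ! j else 0)"
proof -
  have "count (mset (concat (map (\<lambda>j. replicate (f j) j) [0..<k]))) j = (if j < k then f j else 0)"
    for k and f :: "nat \<Rightarrow> nat"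
    by (induction k) auto
  thus ?thesis by (simp add: row_list_def)
qed

lemma length_row_list: "length (row_list S) = sum_list S"
  by (simp add: row_list_def length_concat o_def map_nth)

lemma set_row_list: "set (row_list S) \<subseteq> {..<length S}"
  by (auto simp: row_list_def)

definition list_perm :: "nat \<Rightarrow> complex Matrix.mat \<Rightarrow> nat list \<Rightarrow> complex" where
  "list_perm n U w = (\<Sum>\<tau> | \<tau> permutes {0..<n}. \<Prod>i = 0..<n. U $$ (w ! i, \<tau> i))"

lemma permanent_boson_submat: "permanent (boson_submat n U S) = list_perm n U (row_list S)"
  unfolding permanent_def boson_submat_def list_perm_def
  by (auto intro!: sum.cong prod.cong dest: permutes_in_image[of _ "{0..<n}"])

lemma list_perm_mset_cong:
  assumes "mset v = mset w" "length w = n"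
  shows "list_perm n U v = list_perm n U w"
proof -
  from assms(1) obtain p where p: "p permutes {..<length w}" "permute_list p w = v"
    by (rule mset_eq_permutation)
  have pn: "p permutes {0..<n}"
    using p assms by (simp add: atLeast0LessThan)
  have v: "v ! i = w ! p i" if "i < n" for i
    using p that assms by (auto simp: permute_list_nth)
  have "list_perm n U v = (\<Sum>\<tau> | \<tau> permutes {0..<n}. \<Prod>i = 0..<n. U $$ (v ! i, (\<tau> \<circ> p) i))"
    unfolding list_perm_def by (rule sum_permutations_compose_right[OF pn])
  also have "\<dots> = (\<Sum>\<tau> | \<tau> permutes {0..<n}. \<Prod>i = 0..<n. U $$ (w ! p i, \<tau> (p i)))"
    by (intro sum.cong prod.cong) (auto simp: v)
  also have "\<dots> = list_perm n U w"
    unfolding list_perm_def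
    by (intro sum.cong refl) (rule prod.permute[OF pn, symmetric, unfolded o_def])
  finally show ?thesis .
qed

lemma columns_orthonormal:
  assumes "U \<in> unitary_mats m" "a < m" "b < m"
  shows "(\<Sum>i<m. U $$ (i, a) * cnj (U $$ (i, b))) = (if a = b then 1 else 0)"
proof -
  have U: "U \<in> carrier_mat m m" and *: "mat_adjoint U * U = 1\<^sub>m m"
    using assms by (auto simp: unitary_mats_def)
  have "(mat_adjoint U * U) $$ (b, a) = (\<Sum>i<m. U $$ (i, a) * cnj (U $$ (i, b)))"
    using U assms
    by (auto simp: mat_adjoint_def scalar_prod_def mat_of_rows_def atLeast0LessThan
             intro!: sum.cong)
  thus ?thesis using assms by (auto simp: *)
qed

lemma sum_list_perm_square:
  assumes U: "U \<in> unitary_mats m" and nm: "n \<le> m"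
  shows "(\<Sum>f\<in>{0..<n} \<rightarrow>\<^sub>E {..<m}. (cmod (list_perm n U (map f [0..<n])))\<^sup>2) = fact n"
proof -
  let ?P = "{\<tau>. \<tau> permutes {0..<n}}"
  have fin: "finite ?P" by (simp add: finite_permutations)
  have sq: "complex_of_real ((cmod (list_perm n U (map f [0..<n])))\<^sup>2) =
     (\<Sum>\<sigma>\<in>?P. \<Sum>\<tau>\<in>?P. \<Prod>i = 0..<n. U $$ (f i, \<sigma> i) * cnj (U $$ (f i, \<tau> i)))" for f
    by (subst complex_norm_square)
       (simp add: list_perm_def sum_product prod.distrib)
  have "complex_of_real (\<Sum>f\<in>{0..<n} \<rightarrow>\<^sub>E {..<m}. (cmod (list_perm n U (map f [0..<n])))\<^sup>2) =
     (\<Sum>f\<in>{0..<n} \<rightarrow>\<^sub>E {..<m}. \<Sum>\<sigma>\<in>?P. \<Sum>\<tau>\<in>?P.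
        \<Prod>i = 0..<n. U $$ (f i, \<sigma> i) * cnj (U $$ (f i, \<tau> i)))"
    by (simp add: sq flip: of_real_power)
  also have "\<dots> = (\<Sum>\<sigma>\<in>?P. \<Sum>f\<in>{0..<n} \<rightarrow>\<^sub>E {..<m}. \<Sum>\<tau>\<in>?P.
        \<Prod>i = 0..<n. U $$ (f i, \<sigma> i) * cnj (U $$ (f i, \<tau> i)))"
    by (rule sum.swap)
  also have "\<dots> = (\<Sum>\<sigma>\<in>?P. \<Sum>\<tau>\<in>?P. \<Sum>f\<in>{0..<n} \<rightarrow>\<^sub>E {..<m}.
        \<Prod>i = 0..<n. U $$ (f i, \<sigma> i) * cnj (U $$ (f i, \<tau> i)))"
    by (intro sum.cong refl sum.swap)
  also have "\<dots> = (\<Sum>\<sigma>\<in>?P. \<Sum>\<tau>\<in>?P. \<Prod>i = 0..<n. \<Sum>k<m.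
        U $$ (k, \<sigma> i) * cnj (U $$ (k, \<tau> i)))"
    by (intro sum.cong refl, subst prod_sum_PiE) auto
  also have "\<dots> = (\<Sum>\<sigma>\<in>?P. \<Sum>\<tau>\<in>?P. if \<tau> = \<sigma> then 1 else 0)"
  proof (intro sum.cong refl)
    fix \<sigma> \<tau> assume st: "\<sigma> \<in> ?P" "\<tau> \<in> ?P"
    have lt: "\<rho> i < m" if "\<rho> \<in> ?P" "i < n" for \<rho> i
    proof -
      have "\<rho> i \<in> {0..<n}"
        using that permutes_in_image[of \<rho> "{0..<n}" i] by auto
      with nm show ?thesis by auto
    qed
    have "(\<Prod>i = 0..<n. \<Sum>k<m. U $$ (k, \<sigma> i) * cnj (U $$ (k, \<tau> i))) =
          (\<Prod>i = 0..<n. if \<sigma> i = \<tau> i then 1 else 0)"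
      by (intro prod.cong refl columns_orthonormal[OF U] lt st) auto
    also have "\<dots> = (if \<tau> = \<sigma> then 1 else 0)"
    proof (cases "\<tau> = \<sigma>")
      case False
      then obtain i where i: "\<tau> i \<noteq> \<sigma> i" by auto
      with st have "i < n"
        by (auto simp: permutes_def) (metis atLeast0LessThan lessThan_iff)
      with i False show ?thesis by (auto intro!: prod_zero)
    qed auto
    finally show "(\<Prod>i = 0..<n. \<Sum>k<m. U $$ (k, \<sigma> i) * cnj (U $$ (k, \<tau> i))) =
      (if \<tau> = \<sigma> then 1 else 0)" .
  qed
  also have "\<dots> = of_nat (card ?P)" using fin by simp
  also have "\<dots> = complex_of_real (fact n)" by (simp add: card_permutations[of _ n])
  finally show ?thesis by (simp only: of_real_eq_iff)
qed

lemma sum_boson_mass: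
  assumes U: "U \<in> unitary_mats m" and nm: "n \<le> m"
  shows "(\<Sum>S\<in>occupations m n. boson_mass m n U S) = 1"
proof -
  define L where "L = {w. length w = n \<and> set w \<subseteq> {..<m}}"
  define c where "c = (\<lambda>w. map (count (mset w)) [0..<m])"
  define g where "g = (\<lambda>w. (cmod (list_perm n U w))\<^sup>2)"
  have finL: "finite L"
    unfolding L_def using finite_lists_length_eq[of "{..<m}" n] by (simp add: conj_commute)
  have size: "(\<Sum>j<m. count (mset w) j) = length w" if "set w \<subseteq> {..<m}" for w
    using that sum.mono_neutral_left[of "{..<m}" "set w" "count (mset w)"]
    by (auto simp: count_eq_zero_iff simp flip: size_mset simp: size_multiset_overloaded_eq)
  have c_in: "c w \<in> occupations m n" if "w \<in> L" for w
    using that size[of w]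
    by (auto simp: L_def c_def occupations_def sum_list_sum_nth atLeast0LessThan)
  have fiber: "{w \<in> L. c w = S} = permutations_of_multiset (mset (row_list S))"
    if S: "S \<in> occupations m n" for S
  proof -
    have "c w = S \<longleftrightarrow> mset w = mset (row_list S)" if w: "set w \<subseteq> {..<m}" for w
    proof -
      have "c w = S \<longleftrightarrow> (\<forall>j<m. count (mset w) j = S ! j)"
        using S by (auto simp: c_def occupations_def list_eq_iff_nth_eq)
      also have "\<dots> \<longleftrightarrow> mset w = mset (row_list S)"
        using S w by (auto simp: multiset_eq_iff count_row_list occupations_def count_eq_zero_iff)
      finally show ?thesis .
    qed
    moreover have "w \<in> L" if "mset w = mset (row_list S)" for w
      using S that set_row_list[of S] mset_eq_length[OF that] mset_eq_setD[OF that]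
      by (auto simp: L_def occupations_def length_row_list)
    ultimately show ?thesis
      by (auto simp: permutations_of_multiset_def L_def)
  qed
  have mass: "(\<Sum>w | w \<in> L \<and> c w = S. g w) = fact n * boson_mass m n U S"
    if S: "S \<in> occupations m n" for S
  proof -
    let ?M = "mset (row_list S)"
    have len: "length (row_list S) = n"
      using S by (simp add: occupations_def length_row_list)
    have "(\<Sum>w | w \<in> L \<and> c w = S. g w) =
          (\<Sum>w\<in>permutations_of_multiset ?M. g (row_list S))"
      unfolding fiber[OF S] g_def
      by (intro sum.cong refl arg_cong[where f = "\<lambda>z. (cmod z)\<^sup>2"] list_perm_mset_cong len)
         (simp add: permutations_of_multiset_def)
    also have "\<dots> = real (card (permutations_of_multiset ?M)) * g (row_list S)" by simp
    finally have 1: "(\<Sum>w | w \<in> L \<and> c w = S. g w) =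
      real (card (permutations_of_multiset ?M)) * g (row_list S)" .
    have "real (card (permutations_of_multiset ?M) * (\<Prod>x\<in>set_mset ?M. fact (count ?M x))) =
          real (fact n)"
      using card_permutations_of_multiset_aux[of ?M] len by simp
    hence 2: "real (card (permutations_of_multiset ?M)) * (\<Prod>x\<in>set_mset ?M. fact (count ?M x)) =
          fact n"
      by simp
    have 3: "(\<Prod>x\<in>set_mset ?M. fact (count ?M x)) = (\<Prod>j<m. fact (S ! j) :: real)"
    proof (rule prod.mono_neutral_cong_left)
      show "set_mset ?M \<subseteq> {..<m}" using S set_row_list[of S] by (auto simp: occupations_def)
      show "\<forall>j\<in>{..<m} - set_mset ?M. fact (S ! j) = (1::real)"
      proof
        fix j assume j: "j \<in> {..<m} - set_mset ?M"
        hence "count ?M j = 0" by (simp only: count_eq_zero_iff) simp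
        with j S show "fact (S ! j) = (1::real)" by (simp add: count_row_list occupations_def)
      qed
      show "fact (count ?M x) = (fact (S ! x) :: real)" if "x \<in> set_mset ?M" for x
        using that set_row_list[of S] by (auto simp: count_row_list)
    qed auto
    have "(\<Prod>j<m. fact (S ! j)) \<noteq> (0::real)" by simp
    with 2 3 have "real (card (permutations_of_multiset ?M)) = fact n / (\<Prod>j<m. fact (S ! j))"
      by (simp add: nonzero_eq_divide_eq)
    with 1 show ?thesis
      using S by (simp add: boson_mass_def g_def permanent_boson_submat)
  qed
  have bij: "bij_betw (\<lambda>f. map f [0..<n]) ({0..<n} \<rightarrow>\<^sub>E {..<m}) L"
  proof (rule bij_betw_byWitness[where f' = "\<lambda>w i. if i < n then w ! i else undefined"])
    show "(\<lambda>f. map f [0..<n]) ` ({0..<n} \<rightarrow>\<^sub>E {..<m}) \<subseteq> L"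
      by (auto simp: L_def PiE_def)
    show "(\<lambda>w i. if i < n then w ! i else undefined) ` L \<subseteq> {0..<n} \<rightarrow>\<^sub>E {..<m}"
      by (auto simp: L_def PiE_def extensional_def subset_iff)
  qed (auto simp: L_def PiE_def extensional_def fun_eq_iff intro!: nth_equalityI)
  have "fact n * (\<Sum>S\<in>occupations m n. boson_mass m n U S) =
        (\<Sum>S\<in>occupations m n. \<Sum>w | w \<in> L \<and> c w = S. g w)"
    by (simp add: sum_distrib_left mass)
  also have "\<dots> = (\<Sum>w\<in>L. g w)"
    using c_in by (intro sum.group finL) auto
  also have "\<dots> = (\<Sum>f\<in>{0..<n} \<rightarrow>\<^sub>E {..<m}. g (map f [0..<n]))"
    by (rule sum.reindex_bij_betw[OF bij, symmetric])
  also have "\<dots> = fact n"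
    unfolding g_def by (rule sum_list_perm_square[OF U nm])
  finally show ?thesis by simp
qed

lemma pmf_boson_sampling:
  assumes U: "U \<in> unitary_mats m" and nm: "n \<le> m"
  shows "pmf (boson_sampling m n U) S = boson_mass m n U S"
  unfolding boson_sampling_def
proof (rule pmf_embed_pmf)
  show nn: "0 \<le> boson_mass m n U S" for S
    by (auto simp: boson_mass_def intro!: divide_nonneg_nonneg prod_nonneg)
  have "(\<integral>\<^sup>+ S. ennreal (boson_mass m n U S) \<partial>count_space UNIV) =
        (\<Sum>S\<in>occupations m n. ennreal (boson_mass m n U S))"
    by (rule nn_integral_count_space') (auto simp: boson_mass_def)
  also have "\<dots> = 1"
    using nn by (simp add: sum_ennreal sum_boson_mass[OF U nm])
  finally show "(\<integral>\<^sup>+ S. ennreal (boson_mass m n U S) \<partial>count_space UNIV) = 1" .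
qed

end

(* Both distributions are known, so constantly many samples suffice. On the event where p exceeds q
   the two probabilities differ by half the 1-norm distance. The number of samples that hit this
   event is binomially distributed under either hypothesis, and by Hoeffding's inequality comparing
   it with a threshold between the two means errs with probability at most 1/3 once the number of
   samples is of order 1/\<epsilon>^2. Since n \<ge> 1, this is at most C * n powr (2 + \<gamma>). *)

theory Submission
  imports Defs
begin

lemma map_replicate_pmf: "map_pmf (map f) (replicate_pmf n p) = replicate_pmf n (map_pmf f p)"
proof (induction n)
  case (Suc n)
  have "map_pmf (map f) (replicate_pmf (Suc n) p) =
        bind_pmf p (\<lambda>x. map_pmf ((#) (f x)) (map_pmf (map f) (replicate_pmf n p)))"
    by (simp add: map_bind_pmf pmf.map_comp o_def flip: map_pmf_def)
  also have "\<dots> = replicate_pmf (Suc n) (map_pmf f p)"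
    by (simp add: Suc.IH bind_map_pmf flip: map_pmf_def)
  finally show ?case .
qed simp

lemma map_pmf_mem_eq_bernoulli:
  "map_pmf (\<lambda>x. x \<in> E) p = bernoulli_pmf (measure_pmf.prob p E)"
proof (rule pmf_eqI)
  fix b
  have "(\<lambda>x. x \<in> E) -` {b} = (if b then E else UNIV - E)"
    by auto
  thus "pmf (map_pmf (\<lambda>x. x \<in> E) p) b = pmf (bernoulli_pmf (measure_pmf.prob p E)) b"
    using measure_pmf.prob_compl[of E p] by (simp add: pmf_map)
qed

text \<open>Membership in \<open>E\<close> turns independent samples into independent Bernoulli
  bits. The number of hits is therefore binomial, which makes the binomial tail bounds applicable to
  samples from any distribution.\<close>

lemma map_count_replicate_pmf:
  "map_pmf (\<lambda>xs. length (filter (\<lambda>x. x \<in> E) xs)) (replicate_pmf n p) =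
   binomial_pmf n (measure_pmf.prob p E)"
proof -
  have "binomial_pmf n (measure_pmf.prob p E) =
        map_pmf (length \<circ> filter id) (map_pmf (map (\<lambda>x. x \<in> E)) (replicate_pmf n p))"
    by (subst binomial_pmf_altdef) (simp_all add: map_pmf_mem_eq_bernoulli map_replicate_pmf)
  thus ?thesis
    by (simp add: pmf.map_comp o_def filter_map)
qed

lemma half_l1_dist_on_eq_prob_diff:
  assumes "finite A" "set_pmf p \<subseteq> A" "set_pmf q \<subseteq> A"
  shows "measure_pmf.prob p {x\<in>A. pmf q x < pmf p x} - measure_pmf.prob q {x\<in>A. pmf q x < pmf p x} =
         l1_dist_on A p q / 2"
proof -
  let ?E = "{x\<in>A. pmf q x < pmf p x}" and ?d = "\<lambda>x. pmf p x - pmf q x"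
  \<comment> \<open>Adding this zero sum to the 1-norm replaces each term by
    \<open>\<bar>?d x\<bar> + ?d x\<close>, which is \<open>2 * ?d x\<close> on the event and 0 off
    it.\<close>
  have "(\<Sum>x\<in>A. ?d x) = 0"
    using assms by (simp add: sum_subtractf sum_pmf_eq_1)
  hence "l1_dist_on A p q = (\<Sum>x\<in>A. \<bar>?d x\<bar> + ?d x)"
    by (simp add: l1_dist_on_def sum.distrib)
  also have "\<dots> = (\<Sum>x\<in>?E. 2 * ?d x)"
    using assms(1) by (intro sum.mono_neutral_cong_right) auto
  also have "\<dots> = 2 * (measure_pmf.prob p ?E - measure_pmf.prob q ?E)"
    using assms(1) by (simp add: measure_measure_pmf_finite sum_subtractf flip: sum_distrib_left)
  finally show ?thesis by simp
qed

lemma distinguishes_by_event: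
  fixes \<delta> :: real
  assumes "\<delta> > 0" and gap: "measure_pmf.prob p E - measure_pmf.prob q E \<ge> 2 * \<delta>"
    and l: "real l \<ge> ln 3 / (2 * \<delta>\<^sup>2)"
  shows "\<exists>A. distinguishes A l p q"
proof -
  define N where "N = (\<lambda>xs. length (filter (\<lambda>x. x \<in> E) xs))"
  \<comment> \<open>The threshold for the hit frequency lies \<delta> above its mean under
    \<open>q\<close> and, by the gap, at least \<delta> below its mean under
    \<open>p\<close>.\<close>
  define T where "T = (\<lambda>xs. measure_pmf.prob q E + \<delta> \<le> real (N xs) / real l)"
  have answer: "pmf (bind_pmf (replicate_pmf l r) (\<lambda>xs. return_pmf (T xs))) b =
      measure_pmf.prob (binomial_pmf l (measure_pmf.prob r E))
        {k. (measure_pmf.prob q E + \<delta> \<le> real k / real l) = b}" for r b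
    by (simp add: T_def N_def pmf_map vimage_def flip: map_pmf_def map_count_replicate_pmf[of E])
  interpret P: binomial_distribution l "measure_pmf.prob p E"
    by unfold_locales simp
  interpret Q: binomial_distribution l "measure_pmf.prob q E"
    by unfold_locales simp
  have "0 < ln 3 / (2 * \<delta>\<^sup>2)"
    using \<open>\<delta> > 0\<close> by simp
  with l have "0 < l"
    by linarith
  \<comment> \<open>The constant \<open>ln 3\<close> brings Hoeffding's bound for a deviation of
    \<delta> down to the allowed error 1/3.\<close>
  have "ln 3 \<le> 2 * real l * \<delta>\<^sup>2"
    using l \<open>\<delta> > 0\<close> by (simp add: field_simps)
  hence "exp (- 2 * real l * \<delta>\<^sup>2) \<le> exp (- ln 3)"
    by simp
  hence small: "exp (- 2 * real l * \<delta>\<^sup>2) \<le> 1 / 3"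
    by (simp add: exp_minus)
  \<comment> \<open>A wrong answer under \<open>p\<close> needs a frequency below the threshold,
    which the gap places in the lower tail.\<close>
  have "measure_pmf.prob (binomial_pmf l (measure_pmf.prob p E))
          (UNIV - {k. (measure_pmf.prob q E + \<delta> \<le> real k / real l) = True}) \<le>
        measure_pmf.prob (binomial_pmf l (measure_pmf.prob p E))
          {k. real k / real l \<le> measure_pmf.prob p E - \<delta>}"
    using gap by (intro measure_pmf.finite_measure_mono) auto
  also have "\<dots> \<le> 1 / 3"
    using P.prob_le'[OF \<open>0 < l\<close>, of \<delta>] \<open>\<delta> > 0\<close> small by simp
  finally have accept: "pmf (bind_pmf (replicate_pmf l p) (\<lambda>xs. return_pmf (T xs))) True \<ge> 2 / 3"
    unfolding answer using measure_pmf.prob_compl[of _ "binomial_pmf l (measure_pmf.prob p E)"]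
    by simp
  \<comment> \<open>Under \<open>q\<close> the wrong answers are exactly the upper tail.\<close>
  have "measure_pmf.prob (binomial_pmf l (measure_pmf.prob q E))
          (UNIV - {k. (measure_pmf.prob q E + \<delta> \<le> real k / real l) = False}) \<le>
        measure_pmf.prob (binomial_pmf l (measure_pmf.prob q E))
          {k. real k / real l \<ge> measure_pmf.prob q E + \<delta>}"
    by (intro measure_pmf.finite_measure_mono) auto
  also have "\<dots> \<le> 1 / 3"
    using Q.prob_ge'[OF \<open>0 < l\<close>, of \<delta>] \<open>\<delta> > 0\<close> small by simp
  finally have reject: "pmf (bind_pmf (replicate_pmf l q) (\<lambda>xs. return_pmf (T xs))) False \<ge> 2 / 3"
    unfolding answer using measure_pmf.prob_compl[of _ "binomial_pmf l (measure_pmf.prob q E)"]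
    by simp
  show ?thesis
    using accept reject unfolding distinguishes_def by blast
qed

lemma distinguishes_of_l1_dist_on:
  fixes \<epsilon> :: real
  assumes "finite A" "set_pmf p \<subseteq> A" "set_pmf q \<subseteq> A"
    and "\<epsilon> > 0" "l1_dist_on A p q \<ge> \<epsilon>" "real l \<ge> 8 * ln 3 / \<epsilon>\<^sup>2"
  shows "\<exists>D. distinguishes D l p q"
proof (rule distinguishes_by_event)
  \<comment> \<open>The event has gap at least \<epsilon>/2, which must be
    \<open>2 * \<delta>\<close>; hence \<delta> = \<epsilon>/4, and
    \<open>ln 3 / (2 * \<delta>\<^sup>2)\<close> becomes
    \<open>8 * ln 3 / \<epsilon>\<^sup>2\<close>.\<close>
  show "\<epsilon> / 4 > 0"
    using assms by simp
  show "measure_pmf.prob p {x\<in>A. pmf q x < pmf p x} -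
        measure_pmf.prob q {x\<in>A. pmf q x < pmf p x} \<ge> 2 * (\<epsilon> / 4)"
    using half_l1_dist_on_eq_prob_diff[OF assms(1-3)] assms(5) by simp
  show "real l \<ge> ln 3 / (2 * (\<epsilon> / 4)\<^sup>2)"
    using assms(6) by (simp add: power_divide mult.commute)
qed

lemma set_pmf_boson_sampling:
  assumes "U \<in> unitary_mats m" "n \<le> m"
  shows "set_pmf (boson_sampling m n U) \<subseteq> occupations m n"
  by (auto simp: set_pmf_iff pmf_boson_sampling[OF assms] boson_mass_def split: if_splits)

theorem theorem3:
  fixes \<epsilon> c \<nu> \<gamma> :: real
  assumes "\<epsilon> > 0" and "c \<ge> 0" and "\<nu> \<ge> 1" and "\<gamma> > 0"
  shows "\<exists>C > 0. \<forall>n m :: nat. \<forall>U.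
           1 \<le> n \<longrightarrow> n \<le> m \<longrightarrow> real m \<le> c * real n powr \<nu> \<longrightarrow>
           U \<in> unitary_mats m \<longrightarrow>
           l1_dist_on (occupations m n) (boson_sampling m n U) (pmf_of_set (occupations m n)) \<ge> \<epsilon> \<longrightarrow>
           (\<exists>A. distinguishes A (nat \<lceil>C * real n powr (2 + \<gamma>)\<rceil>)
                  (boson_sampling m n U) (pmf_of_set (occupations m n)))"
\<comment> \<open>The witness is the sample count that suffices at distance \<epsilon> on any finite
  sample space.\<close>
proof (intro exI[of _ "8 * ln 3 / \<epsilon>\<^sup>2"] conjI allI impI)
  show "0 < 8 * ln 3 / \<epsilon>\<^sup>2"
    using assms by simp
  fix n m :: nat and U
  assume n: "1 \<le> n" "n \<le> m" and U: "U \<in> unitary_mats m"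
    and far: "l1_dist_on (occupations m n) (boson_sampling m n U) (pmf_of_set (occupations m n)) \<ge> \<epsilon>"
  let ?C = "8 * ln 3 / \<epsilon>\<^sup>2"
  have "1 \<le> real n powr (2 + \<gamma>)"
    using n assms by (intro ge_one_powr_ge_zero) auto
  hence "?C * 1 \<le> ?C * real n powr (2 + \<gamma>)"
    by (intro mult_left_mono) auto
  also have "\<dots> \<le> real (nat \<lceil>?C * real n powr (2 + \<gamma>)\<rceil>)"
    by (rule real_nat_ceiling_ge)
  finally have l: "?C \<le> real (nat \<lceil>?C * real n powr (2 + \<gamma>)\<rceil>)"
    by simp
  \<comment> \<open>The support of \<open>pmf_of_set\<close> is known only for a nonempty finite
    set; \<open>m\<close> is positive because \<open>1 \<le> n \<le> m\<close>.\<close>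
  have "set_pmf (pmf_of_set (occupations m n)) \<subseteq> occupations m n"
    using n occupations_nonempty[of m n] by simp
  with set_pmf_boson_sampling[OF U n(2)] \<open>\<epsilon> > 0\<close> far l
  show "\<exists>A. distinguishes A (nat \<lceil>?C * real n powr (2 + \<gamma>)\<rceil>)
              (boson_sampling m n U) (pmf_of_set (occupations m n))"
    by (intro distinguishes_of_l1_dist_on[where A = "occupations m n" and \<epsilon> = \<epsilon>]) auto
qed

end
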